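(* Let the correlations of the bivariate Gaussian triangular array satisfy $\rho_n\in[-1,1)$ and assume that $$\lim_{n\to\infty}\frac{\ln b_n}{b_n^2(1-\rho_n)}=0 .$$ Then for all $x>0$, $y>0$, $$\lim_{n\to\infty}b_n^2\left(F_n^{\,n}\big(b_nx^{b_n^{-2}},\,b_ny^{b_n^{-2}}\big)-H_\infty(\ln x,\ln y)\right)=\big(s(x)+s(y)\big)H_\infty(\ln x,\ln y),$$ where $s(x)=\big((\ln x)^2+\ln x\big)x^{-1}$.
   Context: $\Phi$ denotes the standard normal distribution function. The norming constants $b_n$ are defined by $n(1-\Phi(b_n))=1$ (for $n\ge 3$, so $b_n>0$ and $b_n\to\infty$). $\{(X_{n,k},Y_{n,k}):1\le k\le n,\ n\ge1\}$ is a triangular array of independent standard bivariate Gaussian random vectors (zero means, unit variances); all vectors in row $n$ have correlation $\rho_n$, and $F_n$ denotes their common joint distribution function, $F_n(s,t)=\mathbb{P}(X_{n,1}\le s,Y_{n,1}\le t)$. Thus $F_n^{\,n}(s,t)=(F_n(s,t))^n$ is the joint distribution function of the componentwise maxima of row $n$. $H_\infty(s,t)=\exp(-e^{-s})\exp(-e^{-t})$ for $s,t\in\mathbb{R}$, so $H_\infty(\ln x,\ln y)=\exp(-x^{-1}-y^{-1})$ for $x,y>0$. *)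

theory Defs
  imports "HOL-Probability.Probability"
begin

definition std_normal_cdf :: "real \<Rightarrow> real" where
  "std_normal_cdf = cdf std_normal_distribution"

text \<open>Point masses count as Gaussian laws (variance zero); they are needed for correlation \<open>-1\<close>.\<close>

definition gaussian_rv :: "'a measure \<Rightarrow> ('a \<Rightarrow> real) \<Rightarrow> bool" where
  "gaussian_rv M Z \<longleftrightarrow>
     (\<exists>\<mu> \<sigma>. \<sigma> > 0 \<and> distributed M lborel Z (normal_density \<mu> \<sigma>)) \<or>
     (Z \<in> borel_measurable M \<and> (\<exists>\<mu>. AE \<omega> in M. Z \<omega> = \<mu>))"

text \<open>
  A random vector is Gaussian iff all linear combinations of its components are Gaussian. Unlike a
  definition by a joint density this includes the singular case of correlation \<open>-1\<close> or \<open>1\<close>.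
\<close>

definition bivariate_gaussian :: "'a measure \<Rightarrow> ('a \<Rightarrow> real) \<Rightarrow> ('a \<Rightarrow> real) \<Rightarrow> bool" where
  "bivariate_gaussian M X Y \<longleftrightarrow> (\<forall>a b. gaussian_rv M (\<lambda>\<omega>. a * X \<omega> + b * Y \<omega>))"

context prob_space
begin

definition covariance :: "('a \<Rightarrow> real) \<Rightarrow> ('a \<Rightarrow> real) \<Rightarrow> real" where
  "covariance X Y = expectation (\<lambda>\<omega>. (X \<omega> - expectation X) * (Y \<omega> - expectation Y))"

definition correlation :: "('a \<Rightarrow> real) \<Rightarrow> ('a \<Rightarrow> real) \<Rightarrow> real" where
  "correlation X Y = covariance X Y / (sqrt (variance X) * sqrt (variance Y))"

definition std_bivariate_gaussian :: "('a \<Rightarrow> real) \<Rightarrow> ('a \<Rightarrow> real) \<Rightarrow> bool" where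
  "std_bivariate_gaussian X Y \<longleftrightarrow> bivariate_gaussian M X Y \<and>
     expectation X = 0 \<and> expectation Y = 0 \<and> variance X = 1 \<and> variance Y = 1"

text \<open>
  Row \<open>n \<ge> 1\<close> consists of the vectors \<open>(X n k, Y n k)\<close> with \<open>1 \<le> k \<le> n\<close>. Independence is
  required within each row only, which is implied by independence of the whole array.
\<close>

definition gaussian_triangular_array ::
    "(nat \<Rightarrow> real) \<Rightarrow> (nat \<Rightarrow> nat \<Rightarrow> 'a \<Rightarrow> real) \<Rightarrow> (nat \<Rightarrow> nat \<Rightarrow> 'a \<Rightarrow> real) \<Rightarrow> bool" where
  "gaussian_triangular_array \<rho> X Y \<longleftrightarrow>
     (\<forall>n\<ge>1.
        (\<forall>k\<in>{1..n}. std_bivariate_gaussian (X n k) (Y n k) \<and> correlation (X n k) (Y n k) = \<rho> n) \<and>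
        indep_vars (\<lambda>_. borel) (\<lambda>k \<omega>. (X n k \<omega>, Y n k \<omega>)) {1..n})"

definition joint_cdf :: "('a \<Rightarrow> real) \<Rightarrow> ('a \<Rightarrow> real) \<Rightarrow> real \<Rightarrow> real \<Rightarrow> real" where
  "joint_cdf X Y s t = prob {\<omega> \<in> space M. X \<omega> \<le> s \<and> Y \<omega> \<le> t}"

end

definition H_inf :: "real \<Rightarrow> real \<Rightarrow> real" where
  "H_inf s t = exp (- exp (- s)) * exp (- exp (- t))"

definition s_fun :: "real \<Rightarrow> real" where
  "s_fun x = ((ln x)\<^sup>2 + ln x) * inverse x"

end

theory Submission imports Defs "HOL-Real_Asymp.Real_Asymp" begin

text \<open>
  Write \<open>Q = 1 - \<Phi>\<close>, \<open>u = b\<^sub>n x powr (1 / b\<^sub>n\<^sup>2)\<close>, \<open>v = b\<^sub>n y powr (1 / b\<^sub>n\<^sup>2)\<close>, and let \<open>(X, Y)\<close> be a vector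
  of row \<open>n\<close>. Inclusion-exclusion gives \<open>n (1 - F\<^sub>n(u, v)) = n Q(u) + n Q(v) - n P(X > u, Y > v)\<close>, and
  \<open>n = 1 / Q(b\<^sub>n)\<close>. The limit is therefore decided by three facts.

  Each marginal tail satisfies \<open>Q(u) / Q(b\<^sub>n) = 1/x - s(x) / b\<^sub>n\<^sup>2 + o(1 / b\<^sub>n\<^sup>2)\<close>
  (\<open>gaussian_tail_ratio_expansion\<close>). With \<open>L = ln x\<close> one has \<open>u\<^sup>2 = b\<^sub>n\<^sup>2 + 2 L + 2 L\<^sup>2 / b\<^sub>n\<^sup>2 + \<dots>\<close>, so
  the ratio of the densities contributes the \<open>L\<^sup>2\<close> in \<open>s\<close> and the factor \<open>b\<^sub>n / u\<close> of the Mills ratio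
  contributes the \<open>L\<close>. The next factor \<open>1 - 1/t\<^sup>2\<close> of the Mills ratio changes only by \<open>O(1 / b\<^sub>n\<^sup>4)\<close>
  between \<open>t = b\<^sub>n\<close> and \<open>t = u\<close>, but Mills bounds that include it are needed to see this.

  The joint tail is negligible, \<open>n P(X > u, Y > v) = o(1 / b\<^sub>n\<^sup>2)\<close> (\<open>joint_tail_negligible\<close>). The event
  forces \<open>X + Y > u + v\<close>, and \<open>X + Y\<close> is a one-dimensional Gaussian of variance \<open>2 (1 + \<rho>\<^sub>n)\<close>, possibly
  degenerate. Since \<open>u + v\<close> is about \<open>2 b\<^sub>n\<close>, its tail is at most a constant times
  \<open>exp (- b\<^sub>n\<^sup>2 / 2) exp (- b\<^sub>n\<^sup>2 (1 - \<rho>\<^sub>n) / 4)\<close>. The first factor cancels \<open>n\<close> up to a factor of order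
  \<open>b\<^sub>n\<close>; the second is smaller than every power of \<open>b\<^sub>n\<close>, because \<open>b\<^sub>n\<^sup>2 (1 - \<rho>\<^sub>n)\<close> dominates \<open>ln b\<^sub>n\<close>
  by assumption.

  Finally \<open>b\<^sub>n\<^sup>2 / n = b\<^sub>n\<^sup>2 Q(b\<^sub>n)\<close> tends to \<open>0\<close>, so replacing \<open>F\<^sub>n(u, v) ^ n\<close> by
  \<open>exp (- n (1 - F\<^sub>n(u, v)))\<close> costs nothing at the scale \<open>1 / b\<^sub>n\<^sup>2\<close>, and differentiating the exponential
  transfers the expansion of the exponent to the power (\<open>power_minus_exp_limit\<close>).
\<close>

section \<open>Bounds for the tail of the normal distribution\<close>

definition gaussian_tail :: "real \<Rightarrow> real" where
  "gaussian_tail t = 1 - std_normal_cdf t"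

lemma gaussian_tail_eq_measure:
  "gaussian_tail t = measure std_normal_distribution {t<..}"
proof -
  interpret real_distribution std_normal_distribution by (rule real_dist_normal_dist)
  have "- {..t} = {t<..}" by auto
  then show ?thesis
    using prob_compl[of "{..t}"]
    by (simp add: gaussian_tail_def std_normal_cdf_def cdf_def Compl_eq_Diff_UNIV[symmetric])
qed

lemma ennreal_gaussian_tail:
  "ennreal (gaussian_tail t) = (\<integral>\<^sup>+x. ennreal (std_normal_density x) * indicator {t..} x \<partial>lborel)"
proof -
  interpret real_distribution std_normal_distribution by (rule real_dist_normal_dist)
  have "ennreal (gaussian_tail t) = emeasure std_normal_distribution {t<..}"
    unfolding gaussian_tail_eq_measure by (rule emeasure_eq_measure[symmetric])
  also have "\<dots> = (\<integral>\<^sup>+x. ennreal (std_normal_density x) * indicator {t<..} x \<partial>lborel)"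
    by (subst emeasure_density) auto
  also have "\<dots> = (\<integral>\<^sup>+x. ennreal (std_normal_density x) * indicator {t..} x \<partial>lborel)"
    by (rule nn_integral_cong_AE, rule AE_mp[OF AE_lborel_singleton[of t]])
       (auto split: split_indicator)
  finally show ?thesis .
qed

lemma gaussian_tail_nonneg: "0 \<le> gaussian_tail t"
  by (simp add: gaussian_tail_eq_measure)

lemma gaussian_tail_antimono: "s \<le> t \<Longrightarrow> gaussian_tail t \<le> gaussian_tail s"
proof -
  interpret real_distribution std_normal_distribution by (rule real_dist_normal_dist)
  show "s \<le> t \<Longrightarrow> gaussian_tail t \<le> gaussian_tail s"
    unfolding gaussian_tail_eq_measure by (rule finite_measure_mono) auto
qed

text \<open>
  Comparison principle: the tail is the integral of the density, and \<open>G t\<close> is the integral of \<open>g\<close>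
  over \<open>{t..}\<close>. A bound on the tail thus reduces to a pointwise bound on the derivative of a candidate.
\<close>

lemma gaussian_tail_le:
  assumes "g \<in> borel_measurable borel"
    and D: "\<And>x. t \<le> x \<Longrightarrow> (G has_real_derivative - g x) (at x)"
    and le: "\<And>x. t \<le> x \<Longrightarrow> std_normal_density x \<le> g x"
    and lim: "(G \<longlongrightarrow> 0) at_top"
  shows "gaussian_tail t \<le> G t"
proof -
  have nn: "0 \<le> g x" if "t \<le> x" for x
    using le[OF that] normal_density_nonneg[of 0 1 x] by linarith
  have D': "((\<lambda>x. - G x) has_real_derivative g x) (at x)" if "t \<le> x" for x
    using DERIV_minus[OF D[OF that]] by simp
  have "((\<lambda>x. - G x) \<longlongrightarrow> 0) at_top" using tendsto_minus[OF lim] by simp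
  from nn_integral_FTC_atLeast[OF assms(1) D' nn this]
  have eq: "(\<integral>\<^sup>+x. ennreal (g x) * indicator {t..} x \<partial>lborel) = ennreal (G t)" by simp
  have "- G t \<le> 0"
  proof (rule tendsto_lowerbound[OF \<open>((\<lambda>x. - G x) \<longlongrightarrow> 0) at_top\<close>])
    show "\<forall>\<^sub>F x in at_top. - G t \<le> - G x"
      using eventually_ge_at_top[of t]
    proof eventually_elim
      case (elim x)
      show ?case
        by (rule DERIV_nonneg_imp_nondecreasing[OF elim]) (use D' nn in blast)
    qed
  qed simp
  moreover have "ennreal (gaussian_tail t) \<le> ennreal (G t)"
    unfolding ennreal_gaussian_tail eq[symmetric]
    by (rule nn_integral_mono) (auto split: split_indicator intro!: ennreal_leI le)
  ultimately show ?thesis by simp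
qed

lemma gaussian_tail_ge:
  assumes "g \<in> borel_measurable borel"
    and D: "\<And>x. t \<le> x \<Longrightarrow> (G has_real_derivative - g x) (at x)"
    and nn: "\<And>x. t \<le> x \<Longrightarrow> 0 \<le> g x"
    and le: "\<And>x. t \<le> x \<Longrightarrow> g x \<le> std_normal_density x"
    and lim: "(G \<longlongrightarrow> 0) at_top"
  shows "G t \<le> gaussian_tail t"
proof -
  have D': "((\<lambda>x. - G x) has_real_derivative g x) (at x)" if "t \<le> x" for x
    using DERIV_minus[OF D[OF that]] by simp
  have "((\<lambda>x. - G x) \<longlongrightarrow> 0) at_top" using tendsto_minus[OF lim] by simp
  from nn_integral_FTC_atLeast[OF assms(1) D' nn this]
  have eq: "(\<integral>\<^sup>+x. ennreal (g x) * indicator {t..} x \<partial>lborel) = ennreal (G t)" by simp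
  have "ennreal (G t) \<le> ennreal (gaussian_tail t)"
    unfolding ennreal_gaussian_tail eq[symmetric]
    by (rule nn_integral_mono) (auto split: split_indicator intro!: ennreal_leI le)
  then show ?thesis using gaussian_tail_nonneg by (simp add: ennreal_le_iff)
qed

lemma has_real_derivative_std_normal_density:
  "(std_normal_density has_real_derivative - (x * std_normal_density x)) (at x)"
proof -
  have "((\<lambda>x. exp (- x\<^sup>2 / 2)) has_real_derivative - (x * exp (- x\<^sup>2 / 2))) (at x)"
    by (auto intro!: derivative_eq_intros)
  from DERIV_cmult[OF this, of "1 / sqrt (2 * pi)"] show ?thesis
    unfolding std_normal_density_def by simp
qed

text \<open>
  The two Mills bounds come from truncating the asymptotic series
  \<open>Q(t) \<sim> \<phi>(t) (1/t - 1/t\<^sup>3 + 3/t\<^sup>5 - \<dots>)\<close>. Differentiation telescopes, and only the last term kept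
  leaves a correction, whose sign tells on which side of \<open>Q\<close> the truncation lies.
\<close>

lemma gaussian_tail_le_mills:
  assumes "0 < t"
  shows "gaussian_tail t \<le> std_normal_density t * (1/t - 1/t^3 + 3/t^5)"
proof (rule gaussian_tail_le[where g = "\<lambda>x. std_normal_density x * (1 + 15/x^6)"])
  fix x :: real assume "t \<le> x"
  with assms have "x \<noteq> 0" by simp
  then show "((\<lambda>t. std_normal_density t * (1/t - 1/t^3 + 3/t^5))
      has_real_derivative - (std_normal_density x * (1 + 15/x^6))) (at x)"
    by (auto intro!: derivative_eq_intros has_real_derivative_std_normal_density[THEN DERIV_chain2]
        simp: field_simps eval_nat_numeral)
  show "std_normal_density x \<le> std_normal_density x * (1 + 15/x^6)"
    by (simp add: algebra_simps)
next
  show "((\<lambda>t. std_normal_density t * (1/t - 1/t^3 + 3/t^5)) \<longlongrightarrow> 0) at_top"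
    unfolding std_normal_density_def by real_asymp
qed measurable

lemma gaussian_tail_ge_mills:
  assumes "2 \<le> t"
  shows "std_normal_density t * (1/t - 1/t^3) \<le> gaussian_tail t"
proof (rule gaussian_tail_ge[where g = "\<lambda>x. std_normal_density x * (1 - 3/x^4)"])
  fix x :: real assume "t \<le> x"
  with assms have x: "2 \<le> x" "x \<noteq> 0" by auto
  show "((\<lambda>t. std_normal_density t * (1/t - 1/t^3))
      has_real_derivative - (std_normal_density x * (1 - 3/x^4))) (at x)"
    using x(2)
    by (auto intro!: derivative_eq_intros has_real_derivative_std_normal_density[THEN DERIV_chain2]
        simp: field_simps eval_nat_numeral)
  \<comment> \<open>This is where \<open>t \<ge> 2\<close> enters: the comparison function must be nonnegative.\<close>
  have "3 \<le> x^4" using power_mono[OF x(1), of 4] by simp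
  then show "0 \<le> std_normal_density x * (1 - 3/x^4)"
    using x by (intro mult_nonneg_nonneg) auto
  show "std_normal_density x * (1 - 3/x^4) \<le> std_normal_density x"
    by (simp add: algebra_simps)
next
  show "((\<lambda>t. std_normal_density t * (1/t - 1/t^3)) \<longlongrightarrow> 0) at_top"
    unfolding std_normal_density_def by real_asymp
qed measurable

text \<open>For \<open>x \<ge> 1\<close> the density is below \<open>x exp (- x\<^sup>2 / 2)\<close>, which has an elementary antiderivative.\<close>

lemma gaussian_tail_le_exp:
  assumes "1 \<le> t"
  shows "gaussian_tail t \<le> exp (- t\<^sup>2 / 2)"
proof (rule gaussian_tail_le[where g = "\<lambda>x. x * exp (- x\<^sup>2 / 2)"])
  fix x :: real assume "t \<le> x"
  with assms have x: "1 \<le> x" by simp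
  show "((\<lambda>t. exp (- t\<^sup>2 / 2)) has_real_derivative - (x * exp (- x\<^sup>2 / 2))) (at x)"
    by (auto intro!: derivative_eq_intros)
  have "1 \<le> sqrt (2 * pi)" using pi_ge_two by (intro real_le_rsqrt) auto
  then have "1 / sqrt (2 * pi) \<le> x" using x by (simp add: divide_le_eq_1 order_trans[OF _ x])
  then show "std_normal_density x \<le> x * exp (- x\<^sup>2 / 2)"
    unfolding std_normal_density_def by (intro mult_right_mono) auto
next
  show "((\<lambda>t::real. exp (- t\<^sup>2 / 2)) \<longlongrightarrow> 0) at_top" by real_asymp
qed measurable

lemma gaussian_tail_pos: "0 < gaussian_tail t"
proof -
  let ?m = "max t 2"
  have "?m * 1 < ?m * (?m * ?m)" by (intro mult_strict_left_mono) (auto intro: less_1_mult)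
  then have "0 < std_normal_density ?m * (1 / ?m - 1 / ?m^3)"
    by (intro mult_pos_pos normal_density_pos)
       (auto simp: eval_nat_numeral intro!: divide_strict_left_mono)
  also have "\<dots> \<le> gaussian_tail ?m" by (rule gaussian_tail_ge_mills) simp
  also have "\<dots> \<le> gaussian_tail t" by (rule gaussian_tail_antimono) simp
  finally show ?thesis .
qed

section \<open>The marginal expansion and the growth of the norming constants\<close>

text \<open>
  The Mills bounds squeeze the ratio between two explicit elementary functions of \<open>b\<close> that have the
  same expansion up to the order \<open>1 / b\<^sup>2\<close>. Cancelling the density at \<open>b\<close> leaves the factor
  \<open>r b = exp ((b\<^sup>2 - (u b)\<^sup>2) / 2)\<close>, which tends to \<open>exp (- L)\<close>.
\<close>

lemma gaussian_tail_ratio_expansion: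
  fixes L :: real
  shows "((\<lambda>b. b\<^sup>2 * (gaussian_tail (b * exp (L / b\<^sup>2)) / gaussian_tail b - exp (- L)))
           \<longlongrightarrow> - (L\<^sup>2 + L) * exp (- L)) at_top"
proof -
  define u where "u b = b * exp (L / b\<^sup>2)" for b :: real
  define r where "r b = exp (- (u b)\<^sup>2 / 2 + b\<^sup>2 / 2)" for b
  have dens: "std_normal_density (u b) = r b * std_normal_density b" for b
    by (simp add: std_normal_density_def r_def exp_add[symmetric])
  have u: "filterlim u at_top at_top" unfolding u_def by real_asymp
  have ev: "\<forall>\<^sub>F b in at_top. 2 \<le> b \<and> 2 \<le> u b"
    using eventually_ge_at_top[of 2] filterlim_at_top[THEN iffD1, OF u, rule_format, of 2]
    by eventually_elim auto
  show ?thesis unfolding u_def[symmetric]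
  proof (rule tendsto_sandwich)
    show "((\<lambda>b. b\<^sup>2 * (r b * (1 / u b - 1 / u b ^ 3) / (1 / b - 1 / b^3 + 3 / b^5) - exp (- L)))
           \<longlongrightarrow> - (L\<^sup>2 + L) * exp (- L)) at_top"
      unfolding r_def u_def by (real_asymp simp: algebra_simps power2_eq_square)
    show "((\<lambda>b. b\<^sup>2 * (r b * (1 / u b - 1 / u b ^ 3 + 3 / u b ^ 5) / (1 / b - 1 / b^3) - exp (- L)))
           \<longlongrightarrow> - (L\<^sup>2 + L) * exp (- L)) at_top"
      unfolding r_def u_def by (real_asymp simp: algebra_simps power2_eq_square)
    have pos: "0 < 1 / t - 1 / t ^ 3" if "2 \<le> t" for t :: real
    proof -
      have "1 < t * t" using that by (auto intro: less_1_mult)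
      then show ?thesis using that by (simp add: field_simps eval_nat_numeral)
    qed
    have d: "0 < std_normal_density b" for b by (rule normal_density_pos) simp
    show "\<forall>\<^sub>F b in at_top. b\<^sup>2 * (r b * (1 / u b - 1 / u b ^ 3) / (1 / b - 1 / b^3 + 3 / b^5) - exp (- L))
        \<le> b\<^sup>2 * (gaussian_tail (u b) / gaussian_tail b - exp (- L))"
      using ev
    proof eventually_elim
      case (elim b)
      have "r b * (1 / u b - 1 / u b ^ 3) / (1 / b - 1 / b^3 + 3 / b^5)
          = (std_normal_density (u b) * (1 / u b - 1 / u b ^ 3)) / (std_normal_density b * (1 / b - 1 / b^3 + 3 / b^5))"
        unfolding dens using d[of b] by simp
      also have "\<dots> \<le> gaussian_tail (u b) / gaussian_tail b"
        using elim pos[of "u b"] d[of "u b"] gaussian_tail_pos[of b] gaussian_tail_nonneg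
        by (intro frac_le gaussian_tail_ge_mills gaussian_tail_le_mills) auto
      finally show ?case by (intro mult_left_mono) auto
    qed
    show "\<forall>\<^sub>F b in at_top. b\<^sup>2 * (gaussian_tail (u b) / gaussian_tail b - exp (- L))
        \<le> b\<^sup>2 * (r b * (1 / u b - 1 / u b ^ 3 + 3 / u b ^ 5) / (1 / b - 1 / b^3) - exp (- L))"
      using ev
    proof eventually_elim
      case (elim b)
      have "gaussian_tail (u b) / gaussian_tail b
        \<le> (std_normal_density (u b) * (1 / u b - 1 / u b ^ 3 + 3 / u b ^ 5)) / (std_normal_density b * (1 / b - 1 / b^3))"
        using elim pos[of b] d[of b] order_trans[OF gaussian_tail_nonneg gaussian_tail_le_mills[of "u b"]]
        by (intro frac_le gaussian_tail_ge_mills gaussian_tail_le_mills) auto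
      also have "\<dots> = r b * (1 / u b - 1 / u b ^ 3 + 3 / u b ^ 5) / (1 / b - 1 / b^3)"
        unfolding dens using d[of b] by simp
      finally show ?case by (intro mult_left_mono) auto
    qed
  qed
qed

lemma square_times_gaussian_tail: "((\<lambda>b. b\<^sup>2 * gaussian_tail b) \<longlongrightarrow> 0) at_top"
proof (rule tendsto_sandwich[where f = "\<lambda>_. 0"])
  show "\<forall>\<^sub>F b in at_top. b\<^sup>2 * gaussian_tail b \<le> b\<^sup>2 * exp (- b\<^sup>2 / 2)"
    using eventually_ge_at_top[of 1]
    by eventually_elim (intro mult_left_mono gaussian_tail_le_exp zero_le_power2)
  show "((\<lambda>b::real. b\<^sup>2 * exp (- b\<^sup>2 / 2)) \<longlongrightarrow> 0) at_top" by real_asymp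
qed (auto simp: gaussian_tail_nonneg)

text \<open>If \<open>b n\<close> fell below \<open>B\<close>, then \<open>1 / n = Q(b n)\<close> could not fall below \<open>Q(B) > 0\<close>.\<close>

lemma filterlim_gaussian_quantile:
  assumes "\<And>n. n \<ge> N \<Longrightarrow> real n * gaussian_tail (b n) = 1"
  shows "filterlim b at_top sequentially"
  unfolding filterlim_at_top
proof
  fix B :: real
  have "\<forall>\<^sub>F n in sequentially. inverse (real n) < gaussian_tail B"
    by (rule order_tendstoD(2)[OF lim_inverse_n gaussian_tail_pos])
  then show "\<forall>\<^sub>F n in sequentially. B \<le> b n"
    using eventually_ge_at_top[of N] eventually_gt_at_top[of 0]
  proof eventually_elim
    case (elim n)
    show ?case
    proof (rule ccontr)
      assume "\<not> B \<le> b n"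
      then have "gaussian_tail B \<le> gaussian_tail (b n)" by (intro gaussian_tail_antimono) simp
      also have "gaussian_tail (b n) = inverse (real n)"
        using assms[of n] elim by (simp add: field_simps)
      finally show False using elim by simp
    qed
  qed
qed

section \<open>Bivariate Gaussian vectors\<close>

lemma (in prob_space) normal_tail_prob:
  assumes "0 < \<sigma>" and D: "distributed M lborel Z (normal_density \<mu> \<sigma>)"
  shows "prob {\<omega> \<in> space M. t < Z \<omega>} = gaussian_tail ((t - \<mu>) / \<sigma>)"
proof -
  let ?Z = "\<lambda>\<omega>. (Z \<omega> - \<mu>) / \<sigma>"
  have S: "distributed M lborel ?Z std_normal_density"
    using D normal_standard_normal_convert[OF assms(1)] by blast
  have "prob {\<omega> \<in> space M. t < Z \<omega>} = prob (?Z -` {(t - \<mu>) / \<sigma><..} \<inter> space M)"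
    by (rule arg_cong[where f = prob]) (use assms(1) in \<open>auto simp: divide_strict_right_mono divide_less_cancel\<close>)
  also have "\<dots> = measure (distr M lborel ?Z) {(t - \<mu>) / \<sigma><..}"
    by (rule measure_distr[symmetric]) (use distributed_measurable[OF S] in auto)
  also have "distr M lborel ?Z = std_normal_distribution"
    using S by (simp add: distributed_def)
  finally show ?thesis by (simp add: gaussian_tail_eq_measure)
qed

text \<open>Unit variance excludes the degenerate alternative in the definition of a Gaussian law.\<close>

lemma (in prob_space) gaussian_rv_standard:
  assumes "gaussian_rv M Z" "expectation Z = 0" "variance Z = 1"
  shows "distributed M lborel Z std_normal_density"
  using assms(1) unfolding gaussian_rv_def
proof
  assume "\<exists>\<mu> \<sigma>. \<sigma> > 0 \<and> distributed M lborel Z (normal_density \<mu> \<sigma>)"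
  then obtain \<mu> \<sigma> where *: "\<sigma> > 0" "distributed M lborel Z (normal_density \<mu> \<sigma>)" by blast
  have "\<mu> = 0" using normal_distributed_expectation[OF *] assms by simp
  moreover have "\<sigma>\<^sup>2 = 1" using normal_distributed_variance[OF *] assms by simp
  then have "\<sigma> = 1" using *(1) by (simp add: power2_eq_1_iff)
  ultimately show ?thesis using * by simp
next
  assume "Z \<in> borel_measurable M \<and> (\<exists>\<mu>. AE \<omega> in M. Z \<omega> = \<mu>)"
  then obtain \<mu> where m: "Z \<in> borel_measurable M" and ae: "AE \<omega> in M. Z \<omega> = \<mu>" by blast
  have "expectation Z = \<mu>"
    using integral_cong_AE[OF m _ ae] by (simp add: prob_space)
  then have "variance Z = expectation (\<lambda>_. 0)"
    using m ae by (intro integral_cong_AE) auto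
  with assms show ?thesis by simp
qed

lemma (in prob_space) std_bivariate_gaussian_marginals:
  assumes "std_bivariate_gaussian X Y"
  shows "distributed M lborel X std_normal_density" "distributed M lborel Y std_normal_density"
proof -
  have lin: "gaussian_rv M (\<lambda>\<omega>. a * X \<omega> + c * Y \<omega>)" for a c
    using assms by (simp add: std_bivariate_gaussian_def bivariate_gaussian_def)
  show "distributed M lborel X std_normal_density" "distributed M lborel Y std_normal_density"
    using gaussian_rv_standard[of X] gaussian_rv_standard[of Y] lin[of 1 0] lin[of 0 1] assms
    by (auto simp: std_bivariate_gaussian_def)
qed

text \<open>
  The correlation enters the argument only through the variance of \<open>X + Y\<close>. The substance here is that
  \<open>X * Y\<close> is integrable, being dominated by \<open>X\<^sup>2 + Y\<^sup>2\<close>.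
\<close>

lemma (in prob_space) moments_of_sum:
  assumes X: "distributed M lborel X std_normal_density"
    and Y: "distributed M lborel Y std_normal_density"
  shows "expectation (\<lambda>\<omega>. (X \<omega> + Y \<omega>)\<^sup>2) = 2 + 2 * correlation X Y"
    and "expectation (\<lambda>\<omega>. X \<omega> + Y \<omega>) = 0"
proof -
  have EX: "expectation X = 0" "variance X = 1" and EY: "expectation Y = 0" "variance Y = 1"
    using X Y standard_normal_distributed_expectation standard_normal_distributed_variance by auto
  have [measurable]: "X \<in> borel_measurable M" "Y \<in> borel_measurable M"
    using distributed_measurable[OF X] distributed_measurable[OF Y] by auto
  have sq: "integrable M (\<lambda>\<omega>. (Z \<omega>)\<^sup>2)" and one: "integrable M Z"
    if "distributed M lborel Z std_normal_density" for Z :: "'a \<Rightarrow> real"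
    using distributed_integrable[OF that, of "\<lambda>x. x\<^sup>2"] distributed_integrable[OF that, of "\<lambda>x. x"]
      integrable_std_normal_moment[of 2] integrable_std_normal_moment[of 1] by auto
  note [simp] = sq[OF X] sq[OF Y] one[OF X] one[OF Y]
  have xy [simp]: "integrable M (\<lambda>\<omega>. X \<omega> * Y \<omega>)"
  proof (rule Bochner_Integration.integrable_bound[where f = "\<lambda>\<omega>. (X \<omega>)\<^sup>2 + (Y \<omega>)\<^sup>2"])
    show "AE \<omega> in M. norm (X \<omega> * Y \<omega>) \<le> norm ((X \<omega>)\<^sup>2 + (Y \<omega>)\<^sup>2)"
    proof (rule AE_I2)
      fix \<omega>
      have "2 * (\<bar>X \<omega>\<bar> * \<bar>Y \<omega>\<bar>) \<le> \<bar>X \<omega>\<bar>\<^sup>2 + \<bar>Y \<omega>\<bar>\<^sup>2"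
        using sum_squares_bound[of "\<bar>X \<omega>\<bar>" "\<bar>Y \<omega>\<bar>"] by (simp add: mult.assoc)
      moreover have "0 \<le> \<bar>X \<omega>\<bar> * \<bar>Y \<omega>\<bar>" by simp
      ultimately show "norm (X \<omega> * Y \<omega>) \<le> norm ((X \<omega>)\<^sup>2 + (Y \<omega>)\<^sup>2)"
        unfolding real_norm_def abs_mult power2_abs by linarith
    qed
  qed auto
  have "correlation X Y = expectation (\<lambda>\<omega>. X \<omega> * Y \<omega>)"
    using EX EY by (simp add: correlation_def covariance_def)
  moreover have "expectation (\<lambda>\<omega>. (X \<omega> + Y \<omega>)\<^sup>2)
      = expectation (\<lambda>\<omega>. (X \<omega>)\<^sup>2 + (Y \<omega>)\<^sup>2 + 2 * (X \<omega> * Y \<omega>))"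
    by (simp add: power2_sum mult.assoc)
  ultimately show "expectation (\<lambda>\<omega>. (X \<omega> + Y \<omega>)\<^sup>2) = 2 + 2 * correlation X Y"
    using EX EY by simp
  show "expectation (\<lambda>\<omega>. X \<omega> + Y \<omega>) = 0" using EX EY by simp
qed

text \<open>
  The tail of \<open>X + Y\<close> gives the exponent \<open>(u + v)\<^sup>2 / (4 (1 + \<rho>))\<close>. The tangent bound
  \<open>1 / (1 + \<rho>) \<ge> (3 - \<rho>) / 4\<close> at \<open>\<rho> = 1\<close> turns it into a form without a singularity at
  \<open>\<rho> = -1\<close>, where \<open>X + Y\<close> vanishes almost surely, and makes the gain over \<open>\<rho> = 1\<close> linear in
  \<open>1 - \<rho>\<close>.
\<close>

lemma (in prob_space) joint_tail_bound:
  assumes G: "std_bivariate_gaussian X Y" and rho: "correlation X Y < 1" and w: "2 \<le> u + v"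
  shows "prob {\<omega> \<in> space M. u < X \<omega> \<and> v < Y \<omega>} \<le> exp (- ((u + v)\<^sup>2 * (3 - correlation X Y) / 16))"
proof -
  let ?\<rho> = "correlation X Y" and ?S = "\<lambda>\<omega>. X \<omega> + Y \<omega>"
  have "gaussian_rv M (\<lambda>\<omega>. 1 * X \<omega> + 1 * Y \<omega>)"
    using G unfolding std_bivariate_gaussian_def bivariate_gaussian_def by blast
  then have S: "gaussian_rv M ?S" by simp
  note X = std_bivariate_gaussian_marginals(1)[OF G] and Y = std_bivariate_gaussian_marginals(2)[OF G]
  have [measurable]: "X \<in> borel_measurable M" "Y \<in> borel_measurable M"
    using distributed_measurable[OF X] distributed_measurable[OF Y] by auto
  have E: "expectation ?S = 0" and V: "variance ?S = 2 + 2 * ?\<rho>"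
    using moments_of_sum[OF X Y] by simp_all
  have "prob {\<omega> \<in> space M. u < X \<omega> \<and> v < Y \<omega>} \<le> prob {\<omega> \<in> space M. u + v < ?S \<omega>}"
    by (rule finite_measure_mono) auto
  also have "\<dots> \<le> exp (- ((u + v)\<^sup>2 * (3 - ?\<rho>) / 16))"
    using S unfolding gaussian_rv_def
  proof
    assume "\<exists>\<mu> \<sigma>. \<sigma> > 0 \<and> distributed M lborel (\<lambda>\<omega>. X \<omega> + Y \<omega>) (normal_density \<mu> \<sigma>)"
    then obtain \<mu> \<sigma> where s: "\<sigma> > 0" and D: "distributed M lborel ?S (normal_density \<mu> \<sigma>)" by auto
    have mu: "\<mu> = 0" using normal_distributed_expectation[OF s D] E by simp
    have s2: "\<sigma>\<^sup>2 = 2 + 2 * ?\<rho>" using normal_distributed_variance[OF s D] V by simp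
    \<comment> \<open>The exponential bound needs an argument of at least \<open>1\<close>; this is why \<open>u + v \<ge> 2\<close> is assumed.\<close>
    have "\<sigma>\<^sup>2 < 2\<^sup>2" using s2 rho by simp
    then have "\<sigma> < 2" by (rule power2_less_imp_less) simp
    then have "1 \<le> (u + v) / \<sigma>" using s w by simp
    from gaussian_tail_le_exp[OF this]
    have "prob {\<omega> \<in> space M. u + v < ?S \<omega>} \<le> exp (- ((u + v) / \<sigma>)\<^sup>2 / 2)"
      using normal_tail_prob[OF s D] mu by simp
    also have "\<dots> \<le> exp (- ((u + v)\<^sup>2 * (3 - ?\<rho>) / 16))"
    proof -
      have pos: "0 < 1 + ?\<rho>" using s2 s by (smt (verit) zero_less_power)
      have "(3 - ?\<rho>) * (1 + ?\<rho>) = 4 - (1 - ?\<rho>)\<^sup>2" by (simp add: power2_eq_square algebra_simps)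
      then have "(3 - ?\<rho>) * (1 + ?\<rho>) \<le> 4" by simp
      then have "(3 - ?\<rho>) / 16 \<le> 1 / (4 * (1 + ?\<rho>))" using pos by (simp add: field_simps)
      from mult_left_mono[OF this, of "(u + v)\<^sup>2"]
      show ?thesis by (simp add: power_divide s2)
    qed
    finally show ?thesis .
  next
    assume "?S \<in> borel_measurable M \<and> (\<exists>\<mu>. AE \<omega> in M. X \<omega> + Y \<omega> = \<mu>)"
    then obtain \<mu> where ae: "AE \<omega> in M. ?S \<omega> = \<mu>" by auto
    have "expectation ?S = expectation (\<lambda>_. \<mu>)" by (rule integral_cong_AE) (use ae in auto)
    then have "\<mu> = 0" using E by (simp add: prob_space)
    then have "prob {\<omega> \<in> space M. u + v < ?S \<omega>} = prob {}"
      using ae w by (intro finite_measure_eq_AE) auto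
    then show ?thesis by simp
  qed
  finally show ?thesis .
qed

lemma (in prob_space) joint_cdf_eq:
  assumes X: "distributed M lborel X std_normal_density" and Y: "distributed M lborel Y std_normal_density"
  shows "joint_cdf X Y u v = 1 - gaussian_tail u - gaussian_tail v + prob {\<omega> \<in> space M. u < X \<omega> \<and> v < Y \<omega>}"
proof -
  have [measurable]: "X \<in> borel_measurable M" "Y \<in> borel_measurable M"
    using distributed_measurable[OF X] distributed_measurable[OF Y] by auto
  let ?A = "{\<omega> \<in> space M. u < X \<omega>}" and ?B = "{\<omega> \<in> space M. v < Y \<omega>}"
  have "{\<omega> \<in> space M. X \<omega> \<le> u \<and> Y \<omega> \<le> v} = space M - (?A \<union> ?B)" by auto
  then have "joint_cdf X Y u v = 1 - prob (?A \<union> ?B)"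
    unfolding joint_cdf_def by (simp add: prob_compl)
  also have "prob (?A \<union> ?B) = prob ?A + prob ?B - prob (?A \<inter> ?B)"
    by (rule measure_Un3) (auto simp: fmeasurable_eq_sets)
  also have "?A \<inter> ?B = {\<omega> \<in> space M. u < X \<omega> \<and> v < Y \<omega>}" by auto
  finally show ?thesis
    using normal_tail_prob[of 1 X 0 u] normal_tail_prob[of 1 Y 0 v] X Y by simp
qed

section \<open>From the exponent to the power\<close>

text \<open>
  Two errors are compared at the scale \<open>1 / \<beta>\<close>. Replacing \<open>f ^ n\<close> by \<open>exp (- q)\<close> costs at most
  \<open>n (1 - f)\<^sup>2 = q\<^sup>2 / n\<close>, which is negligible as \<open>\<beta> / n\<close> tends to \<open>0\<close>; what remains is a difference
  quotient of \<open>exp (- z)\<close> at \<open>a\<close>.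
\<close>

lemma power_minus_exp_limit:
  fixes q \<beta> f :: "nat \<Rightarrow> real"
  assumes q: "\<forall>\<^sub>F n in sequentially. q n = real n * (1 - f n)"
    and f: "\<forall>\<^sub>F n in sequentially. 0 \<le> f n \<and> f n \<le> 1"
    and lim: "(\<lambda>n. \<beta> n * (q n - a)) \<longlonglongrightarrow> c"
    and beta: "filterlim \<beta> at_top sequentially" and beta_n: "(\<lambda>n. \<beta> n / real n) \<longlonglongrightarrow> 0"
  shows "(\<lambda>n. \<beta> n * (f n ^ n - exp (- a))) \<longlonglongrightarrow> - c * exp (- a)"
proof -
  have "(\<lambda>n. \<beta> n * (q n - a) / \<beta> n) \<longlonglongrightarrow> 0"
    by (rule real_tendsto_divide_at_top[OF lim beta])
  moreover have "\<forall>\<^sub>F n in sequentially. \<beta> n > 0"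
    using beta by (auto simp: filterlim_at_top_dense)
  then have "\<forall>\<^sub>F n in sequentially. \<beta> n * (q n - a) / \<beta> n = q n - a"
    by eventually_elim simp
  ultimately have "(\<lambda>n. q n - a) \<longlonglongrightarrow> 0" by (rule Lim_transform_eventually)
  then have qa: "q \<longlonglongrightarrow> a" by (simp add: LIM_zero_iff)
  have "((\<lambda>z. exp (- z)) has_real_derivative - exp (- a)) (at a)"
    by (auto intro!: derivative_eq_intros)
  \<comment> \<open>Caratheodory's form of the derivative avoids dividing by \<open>q n - a\<close>, which may vanish.\<close>
  then obtain g where g: "\<And>z. exp (- z) - exp (- a) = g z * (z - a)"
      and cont: "isCont g a" and ga: "g a = - exp (- a)"
    unfolding CARAT_DERIV by blast
  have "(\<lambda>n. g (q n) * (\<beta> n * (q n - a))) \<longlonglongrightarrow> g a * c"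
    by (intro tendsto_mult isCont_tendsto_compose[OF cont qa] lim)
  then have main: "(\<lambda>n. \<beta> n * (exp (- q n) - exp (- a))) \<longlonglongrightarrow> - c * exp (- a)"
    by (simp add: g ga mult_ac)
  have err: "(\<lambda>n. \<beta> n * (f n ^ n - exp (- q n))) \<longlonglongrightarrow> 0"
  proof (rule Lim_null_comparison)
    show "(\<lambda>n. \<beta> n / real n * (q n)\<^sup>2) \<longlonglongrightarrow> 0"
      using tendsto_mult[OF beta_n tendsto_power[OF qa, of 2]] by simp
    show "\<forall>\<^sub>F n in sequentially. norm (\<beta> n * (f n ^ n - exp (- q n))) \<le> \<beta> n / real n * (q n)\<^sup>2"
      using q f \<open>\<forall>\<^sub>F n in sequentially. \<beta> n > 0\<close> eventually_gt_at_top[of 0]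
    proof eventually_elim
      case (elim n)
      define t where "t = 1 - f n"
      have t: "0 \<le> t" "t \<le> 1" "f n = 1 - t" "q n = real n * t" using elim by (auto simp: t_def)
      have "exp (- q n) = exp (- t) ^ n" by (simp add: t exp_of_nat_mult[symmetric])
      then have "norm (f n ^ n - exp (- q n)) \<le> real n * norm (f n - exp (- t))"
        using elim t norm_power_diff[of "f n" "exp (- t)" n] by simp
      also have "norm (f n - exp (- t)) \<le> t\<^sup>2"
      proof -
        have "1 - t \<le> exp (- t)" using exp_ge_add_one_self[of "- t"] by simp
        moreover have "exp (- t) \<le> 1 / (1 + t)"
          using exp_ge_add_one_self[of t] t by (simp add: exp_minus field_simps)
        moreover have "1 / (1 + t) \<le> 1 - t + t\<^sup>2"
          using t by (simp add: field_simps power2_eq_square)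
        ultimately show ?thesis using t by simp
      qed
      finally have "norm (f n ^ n - exp (- q n)) \<le> real n * t\<^sup>2" by (simp add: mult_left_mono)
      also have "\<dots> = (q n)\<^sup>2 / real n" using elim t by (simp add: power2_eq_square)
      finally have "\<beta> n * norm (f n ^ n - exp (- q n)) \<le> \<beta> n * ((q n)\<^sup>2 / real n)"
        using elim by (intro mult_left_mono) auto
      then show ?case using elim by (simp add: abs_mult)
    qed
  qed
  from tendsto_add[OF main err] show ?thesis by (simp add: algebra_simps)
qed

section \<open>Negligibility of the joint tail\<close>

text \<open>
  The square \<open>(u + v)\<^sup>2\<close> is at least \<open>4 (b\<^sup>2 + 2 c)\<close>, and \<open>(3 - r) / 4 = 1/2 + (1 - r) / 4\<close>. The part
  \<open>b\<^sup>2 / 2\<close> matches the exponent of the normal density at \<open>b\<close>, the part \<open>b\<^sup>2 (1 - r) / 4\<close> exceeds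
  \<open>4 ln b\<close> or equals it, and \<open>c\<close> costs a constant factor only. A fourth power of \<open>b\<close> is gained: one power pays for
  \<open>1/b\<close> in the Mills ratio and two pay for the norming \<open>b\<^sup>2\<close>.
\<close>

lemma joint_exponent_bound:
  fixes b r c u v :: real
  assumes b: "0 < b" "0 \<le> b + c / b" and r: "-1 \<le> r" "r < 1"
    and uv: "2 * (b + c / b) \<le> u + v"
    and gap: "16 * ln b \<le> b\<^sup>2 * (1 - r)"
  shows "exp (- ((u + v)\<^sup>2 * (3 - r) / 16)) \<le> exp (2 * \<bar>c\<bar>) * exp (- b\<^sup>2 / 2) / b ^ 4"
proof -
  have "(2 * (b + c / b))\<^sup>2 \<le> (u + v)\<^sup>2" using uv b by (intro power_mono) auto
  moreover have "(2 * (b + c / b))\<^sup>2 = 4 * (b\<^sup>2 + 2 * c) + 4 * (c / b)\<^sup>2"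
    using b by (simp add: power2_eq_square field_simps)
  ultimately have "4 * (b\<^sup>2 + 2 * c) \<le> (u + v)\<^sup>2" by (smt (verit) zero_le_power2)
  then have "4 * (b\<^sup>2 + 2 * c) * (3 - r) \<le> (u + v)\<^sup>2 * (3 - r)"
    using r by (intro mult_right_mono) auto
  moreover have "\<bar>c\<bar> * (3 - r) \<le> \<bar>c\<bar> * 4" using r by (intro mult_left_mono) auto
  moreover have "- \<bar>c\<bar> * (3 - r) \<le> c * (3 - r)" using r by (intro mult_right_mono) auto
  moreover have "4 * (b\<^sup>2 + 2 * c) * (3 - r) = 8 * b\<^sup>2 + 4 * (b\<^sup>2 * (1 - r)) + 8 * (c * (3 - r))"
    by (simp add: algebra_simps)
  ultimately have "8 * b\<^sup>2 + 64 * ln b - 32 * \<bar>c\<bar> \<le> (u + v)\<^sup>2 * (3 - r)"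
    using gap by linarith
  then have "- ((u + v)\<^sup>2 * (3 - r) / 16) \<le> 2 * \<bar>c\<bar> + - b\<^sup>2 / 2 - 4 * ln b" by simp
  then have "exp (- ((u + v)\<^sup>2 * (3 - r) / 16)) \<le> exp (2 * \<bar>c\<bar> + - b\<^sup>2 / 2 - 4 * ln b)" by simp
  also have "\<dots> = exp (2 * \<bar>c\<bar>) * exp (- b\<^sup>2 / 2) / exp (4 * ln b)"
    by (simp only: exp_diff exp_add)
  also have "exp (4 * ln b) = b ^ 4" using b exp_of_nat_mult[of 4 "ln b"] by simp
  finally show ?thesis .
qed

lemma joint_tail_negligible:
  fixes b r J u v :: "nat \<Rightarrow> real"
  assumes b: "filterlim b at_top sequentially"
    and r: "\<forall>\<^sub>F n in sequentially. -1 \<le> r n \<and> r n < 1"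
    and gap: "(\<lambda>n. ln (b n) / ((b n)\<^sup>2 * (1 - r n))) \<longlonglongrightarrow> 0"
    and uv: "\<forall>\<^sub>F n in sequentially. 2 * (b n + c / b n) \<le> u n + v n"
    and J: "\<forall>\<^sub>F n in sequentially. 0 \<le> J n \<and> J n \<le> exp (- ((u n + v n)\<^sup>2 * (3 - r n) / 16))"
  shows "(\<lambda>n. (b n)\<^sup>2 * (J n / gaussian_tail (b n))) \<longlonglongrightarrow> 0"
proof (rule Lim_null_comparison)
  define h where "h t = t\<^sup>2 * (exp (2 * \<bar>c\<bar>) * exp (- t\<^sup>2 / 2) / t ^ 4
      / (std_normal_density t * (1 / t - 1 / t ^ 3)))" for t :: real
  have "(h \<longlongrightarrow> 0) at_top" unfolding h_def std_normal_density_def by real_asymp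
  then show "(\<lambda>n. h (b n)) \<longlonglongrightarrow> 0" by (rule filterlim_compose[OF _ b])
  have "\<forall>\<^sub>F t::real in at_top. 0 \<le> t + c / t" by real_asymp
  then have "\<forall>\<^sub>F n in sequentially. 0 \<le> b n + c / b n" by (rule eventually_compose_filterlim[OF _ b])
  moreover have "\<forall>\<^sub>F n in sequentially. 2 \<le> b n" using b by (simp add: filterlim_at_top)
  moreover have "\<forall>\<^sub>F n in sequentially. ln (b n) / ((b n)\<^sup>2 * (1 - r n)) < 1 / 16"
    by (rule order_tendstoD(2)[OF gap]) simp
  ultimately show "\<forall>\<^sub>F n in sequentially. norm ((b n)\<^sup>2 * (J n / gaussian_tail (b n))) \<le> h (b n)"
    using r uv J
  proof eventually_elim
    case (elim n)
    have "0 < (b n)\<^sup>2 * (1 - r n)" using elim by simp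
    then have "16 * ln (b n) \<le> (b n)\<^sup>2 * (1 - r n)" using elim(3) by (simp add: field_simps)
    with elim have "J n \<le> exp (2 * \<bar>c\<bar>) * exp (- (b n)\<^sup>2 / 2) / b n ^ 4"
      by (intro order_trans[OF _ joint_exponent_bound]) auto
    moreover have "1 < b n * b n" using elim by (intro less_1_mult) auto
    then have "0 < 1 / b n - 1 / b n ^ 3" using elim by (simp add: field_simps eval_nat_numeral)
    then have "0 < std_normal_density (b n) * (1 / b n - 1 / b n ^ 3)"
      by (intro mult_pos_pos normal_density_pos) auto
    ultimately have "J n / gaussian_tail (b n) \<le> exp (2 * \<bar>c\<bar>) * exp (- (b n)\<^sup>2 / 2) / b n ^ 4
        / (std_normal_density (b n) * (1 / b n - 1 / b n ^ 3))"
      using elim by (intro frac_le gaussian_tail_ge_mills) auto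
    then have "(b n)\<^sup>2 * (J n / gaussian_tail (b n)) \<le> h (b n)"
      unfolding h_def by (intro mult_left_mono) auto
    then show ?case using elim gaussian_tail_nonneg[of "b n"] by simp
  qed
qed

section \<open>The second-order expansion of the joint distribution of the maxima\<close>

theorem theorem2p3:
  fixes M :: "'a measure"
    and X Y :: "nat \<Rightarrow> nat \<Rightarrow> 'a \<Rightarrow> real"
    and \<rho> b :: "nat \<Rightarrow> real"
    and F :: "nat \<Rightarrow> real \<Rightarrow> real \<Rightarrow> real"
    and x y :: real
  assumes "prob_space M"
    and "prob_space.gaussian_triangular_array M \<rho> X Y"
    and "\<And>n. n \<ge> 1 \<Longrightarrow> -1 \<le> \<rho> n \<and> \<rho> n < 1"
    and "\<And>n s t. n \<ge> 1 \<Longrightarrow> F n s t = prob_space.joint_cdf M (X n 1) (Y n 1) s t"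
    and "\<And>n. n \<ge> 3 \<Longrightarrow> real n * (1 - std_normal_cdf (b n)) = 1"
    and "(\<lambda>n. ln (b n) / ((b n)\<^sup>2 * (1 - \<rho> n))) \<longlonglongrightarrow> 0"
    and "x > 0" and "y > 0"
  shows "(\<lambda>n. (b n)\<^sup>2 *
            ((F n (b n * x powr (1 / (b n)\<^sup>2)) (b n * y powr (1 / (b n)\<^sup>2))) ^ n
              - H_inf (ln x) (ln y)))
         \<longlonglongrightarrow> (s_fun x + s_fun y) * H_inf (ln x) (ln y)"
proof -
  interpret prob_space M by fact
  define u where "u n = b n * exp (ln x / (b n)\<^sup>2)" for n
  define v where "v n = b n * exp (ln y / (b n)\<^sup>2)" for n
  have u: "b n * x powr (1 / (b n)\<^sup>2) = u n" and v: "b n * y powr (1 / (b n)\<^sup>2) = v n" for n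
    using assms(7,8) by (simp_all add: u_def v_def powr_def)
  have tail: "real n * gaussian_tail (b n) = 1" if "n \<ge> 3" for n
    using assms(5)[OF that] by (simp add: gaussian_tail_def)
  have b: "filterlim b at_top sequentially" by (rule filterlim_gaussian_quantile[OF tail])
  define J where "J n = prob {\<omega> \<in> space M. u n < X n 1 \<omega> \<and> v n < Y n 1 \<omega>}" for n
  define f where "f n = F n (u n) (v n)" for n
  define q where "q n = gaussian_tail (u n) / gaussian_tail (b n)
      + gaussian_tail (v n) / gaussian_tail (b n) - J n / gaussian_tail (b n)" for n
  have G: "std_bivariate_gaussian (X n 1) (Y n 1)" and corr: "correlation (X n 1) (Y n 1) = \<rho> n"
    if "n \<ge> 1" for n
    using assms(2) that unfolding gaussian_triangular_array_def by auto
  have N: "distributed M lborel (X n 1) std_normal_density"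
      "distributed M lborel (Y n 1) std_normal_density" if "n \<ge> 1" for n
    using std_bivariate_gaussian_marginals[OF G[OF that]] by auto
  have f_eq: "f n = 1 - gaussian_tail (u n) - gaussian_tail (v n) + J n" if "n \<ge> 1" for n
    using joint_cdf_eq[OF N[OF that]] assms(4)[OF that] by (simp add: f_def J_def)
  have f01: "0 \<le> f n \<and> f n \<le> 1" if "n \<ge> 1" for n
    using assms(4)[OF that] by (simp add: f_def joint_cdf_def)
  have q_eq: "q n = real n * (1 - f n)" if "n \<ge> 3" for n
  proof -
    have "real n = 1 / gaussian_tail (b n)"
      using tail[OF that] gaussian_tail_pos[of "b n"] by (simp add: field_simps)
    then show ?thesis using f_eq[of n] that by (simp add: q_def diff_divide_distrib add_divide_distrib)
  qed
  \<comment> \<open>By \<open>exp z \<ge> 1 + z\<close> the thresholds sum to at least \<open>2 (b + c / b)\<close>.\<close>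
  define c where "c = (ln x + ln y) / 2"
  have linear: "b n + l / b n \<le> b n * exp (l / (b n)\<^sup>2)" if "0 < b n" for n l
  proof -
    have "b n * (1 + l / (b n)\<^sup>2) \<le> b n * exp (l / (b n)\<^sup>2)"
      using that by (intro mult_left_mono exp_ge_add_one_self) auto
    moreover have "b n * (1 + l / (b n)\<^sup>2) = b n + l / b n"
      using that by (simp add: field_simps power2_eq_square)
    ultimately show ?thesis by simp
  qed
  have b_pos: "\<forall>\<^sub>F n in sequentially. 0 < b n" using b by (simp add: filterlim_at_top_dense)
  then have uv: "\<forall>\<^sub>F n in sequentially. 2 * (b n + c / b n) \<le> u n + v n"
  proof eventually_elim
    case (elim n)
    show ?case using linear[OF elim, of "ln x"] linear[OF elim, of "ln y"]
      by (simp add: u_def v_def c_def add_divide_distrib)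
  qed
  have "\<forall>\<^sub>F t::real in at_top. 1 \<le> t + c / t" by real_asymp
  then have "\<forall>\<^sub>F n in sequentially. 1 \<le> b n + c / b n" by (rule eventually_compose_filterlim[OF _ b])
  then have "\<forall>\<^sub>F n in sequentially. 0 \<le> J n \<and> J n \<le> exp (- ((u n + v n)\<^sup>2 * (3 - \<rho> n) / 16))"
    using uv eventually_ge_at_top[of 1]
  proof eventually_elim
    case (elim n)
    then show ?case
      using joint_tail_bound[OF G, of n "u n" "v n"] corr[of n] assms(3)[of n] by (simp add: J_def)
  qed
  moreover have "\<forall>\<^sub>F n in sequentially. -1 \<le> \<rho> n \<and> \<rho> n < 1"
    using eventually_ge_at_top[of 1] by eventually_elim (rule assms(3))
  ultimately have J: "(\<lambda>n. (b n)\<^sup>2 * (J n / gaussian_tail (b n))) \<longlonglongrightarrow> 0"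
    using joint_tail_negligible[OF b _ assms(6) uv] by blast
  have marginal: "(\<lambda>n. (b n)\<^sup>2 * (gaussian_tail (b n * exp (ln z / (b n)\<^sup>2)) / gaussian_tail (b n) - inverse z))
      \<longlonglongrightarrow> - s_fun z" if "z > 0" for z
    using filterlim_compose[OF gaussian_tail_ratio_expansion[of "ln z"] b] that
    by (simp add: exp_minus s_fun_def algebra_simps)
  have "(\<lambda>n. (b n)\<^sup>2 * (q n - (inverse x + inverse y))) \<longlonglongrightarrow> - s_fun x + - s_fun y - 0"
    using tendsto_diff[OF tendsto_add[OF marginal[OF assms(7)] marginal[OF assms(8)]] J]
    by (simp add: q_def u_def v_def algebra_simps)
  moreover have "filterlim (\<lambda>n. (b n)\<^sup>2) at_top sequentially"
    by (rule filterlim_pow_at_top[OF _ b]) simp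
  moreover have "(\<lambda>n. (b n)\<^sup>2 / real n) \<longlonglongrightarrow> 0"
  proof (rule Lim_transform_eventually)
    show "(\<lambda>n. (b n)\<^sup>2 * gaussian_tail (b n)) \<longlonglongrightarrow> 0"
      by (rule filterlim_compose[OF square_times_gaussian_tail b])
    show "\<forall>\<^sub>F n in sequentially. (b n)\<^sup>2 * gaussian_tail (b n) = (b n)\<^sup>2 / real n"
      using eventually_ge_at_top[of 3]
    proof eventually_elim
      case (elim n)
      then have "gaussian_tail (b n) = 1 / real n" using tail[OF elim] by (simp add: field_simps)
      then show ?case by simp
    qed
  qed
  moreover have "\<forall>\<^sub>F n in sequentially. q n = real n * (1 - f n)"
    using eventually_ge_at_top[of 3] by eventually_elim (rule q_eq)
  moreover have "\<forall>\<^sub>F n in sequentially. 0 \<le> f n \<and> f n \<le> 1"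
    using eventually_ge_at_top[of 1] by eventually_elim (rule f01)
  ultimately have "(\<lambda>n. (b n)\<^sup>2 * (f n ^ n - exp (- (inverse x + inverse y))))
      \<longlonglongrightarrow> - (- s_fun x + - s_fun y - 0) * exp (- (inverse x + inverse y))"
    by (intro power_minus_exp_limit[where q = q]) auto
  moreover have "H_inf (ln x) (ln y) = exp (- (inverse x + inverse y))"
    using assms(7,8) by (simp add: H_inf_def exp_minus[of "ln x"] exp_minus[of "ln y"] mult_exp_exp)
  ultimately show ?thesis by (simp add: u v f_def[symmetric] add.commute)
qed
end
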